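(* $\mathbb{P}$-almost surely, the sup-norm Brownian frame process $\mathcal{T}^{B}:[0,1]\to(C([0,1]),\|\cdot\|_\infty)$ has finite $\acute{p}$-variation for $\acute{p}>2$. Furthermore, $\mathbb{P}$-almost surely, the dyadic polygonal approximations $\mathcal{T}^{B}(m)$ converge to $\mathcal{T}^{B}$ in $\acute{p}$-variation as $m\to\infty$, for $\acute{p}>2$.
   Context: $C_0([-1,1])$ is the space of continuous $f:[-1,1]\to\mathbb{R}$ with $f(-1)=0$, with the sup-norm, equipped with the $\mathbb{P}$-completed Borel $\sigma$-algebra, where $\mathbb{P}$ is Wiener measure (under which the coordinate process $B_t(f)=f(t)$, $t\in[-1,1]$, is a Brownian motion started from $0$ at time $-1$). For $h\in[0,1]$, $\mathcal{T}^B_h(f):=\mathcal{T}^f_h\in C([0,1])$, where $\mathcal{T}^f_h(u):=f(h-1+u)$, $u\in[0,1]$. For a path $x:[0,1]\to V$ in a Banach space $V$ and $q\ge1$, $\mathcal{V}_q(x):=\sup_D\big(\sum_{D}|x_{t_{i+1}}-x_{t_i}|_V^q\big)^{1/q}$, the supremum over all finite dissections $D=\{0=t_0<\dots<t_n=1\}$; $x$ has finite $q$-variation if $\mathcal{V}_q(x)<\infty$, and $x(m)\to x$ in $q$-variation if $\mathcal{V}_q(x(m)-x)\to0$. The $m$-th dyadic polygonal approximation of a $V$-valued path $X$ on $[0,1]$ is $X(m)_t:=X_{\frac{k-1}{2^m}}+2^m\big(t-\frac{k-1}{2^m}\big)\big(X_{\frac{k}{2^m}}-X_{\frac{k-1}{2^m}}\big)$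 for $\frac{k-1}{2^m}\le t\le\frac{k}{2^m}$, $1\le k\le 2^m$. Here $V=(C([0,1]),\|\cdot\|_\infty)$. *)

theory Defs
  imports "HOL-Probability.Probability"
begin

instance bcontfun :: (metric_space, banach) banach ..


section \<open>The compact intervals [0,1] and [-1,1] as metric spaces\<close>

text \<open>Having the intervals as types makes \<open>unit_icc \<Rightarrow>\<^sub>C real\<close> the Banach space C([0,1]) and
  \<open>sym_icc \<Rightarrow>\<^sub>C real\<close> the Banach space C([-1,1]), each with the library's sup-norm; the boundedness
  that \<open>bcontfun\<close> demands is automatic by compactness (see \<open>bcontfun_unit_icc\<close> and
  \<open>bcontfun_sym_icc\<close> below).\<close>

typedef unit_icc = "{0..1::real}"
  morphisms of_unit to_unit
  by auto

typedef sym_icc = "{-1..1::real}"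
  morphisms of_sym to_sym
  by auto

instantiation unit_icc :: metric_space
begin

definition dist_unit_icc :: "unit_icc \<Rightarrow> unit_icc \<Rightarrow> real" where
  "dist_unit_icc s t = dist (of_unit s) (of_unit t)"

definition uniformity_unit_icc :: "(unit_icc \<times> unit_icc) filter" where
  "uniformity_unit_icc = (INF e\<in>{0<..}. principal {(x, y). dist x y < e})"

definition open_unit_icc :: "unit_icc set \<Rightarrow> bool" where
  "open_unit_icc U = (\<forall>x\<in>U. \<forall>\<^sub>F (x', y) in uniformity. x' = x \<longrightarrow> y \<in> U)"

instance
  by standard
    (auto simp: dist_unit_icc_def uniformity_unit_icc_def open_unit_icc_def of_unit_inject
      dist_triangle2)

end

instantiation sym_icc :: metric_space
begin

definition dist_sym_icc :: "sym_icc \<Rightarrow> sym_icc \<Rightarrow> real" where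
  "dist_sym_icc s t = dist (of_sym s) (of_sym t)"

definition uniformity_sym_icc :: "(sym_icc \<times> sym_icc) filter" where
  "uniformity_sym_icc = (INF e\<in>{0<..}. principal {(x, y). dist x y < e})"

definition open_sym_icc :: "sym_icc set \<Rightarrow> bool" where
  "open_sym_icc U = (\<forall>x\<in>U. \<forall>\<^sub>F (x', y) in uniformity. x' = x \<longrightarrow> y \<in> U)"

instance
  by standard
    (auto simp: dist_sym_icc_def uniformity_sym_icc_def open_sym_icc_def of_sym_inject
      dist_triangle2)

end

lemma continuous_on_of_unit [continuous_intros]: "continuous_on S of_unit"
  unfolding continuous_on_iff dist_unit_icc_def by auto

lemma continuous_on_of_sym [continuous_intros]: "continuous_on S of_sym"
  unfolding continuous_on_iff dist_sym_icc_def by auto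

lemma continuous_on_to_unit: "continuous_on {0..1} to_unit"
  unfolding continuous_on_iff dist_unit_icc_def by (auto simp: to_unit_inverse)

lemma continuous_on_to_sym: "continuous_on {-1..1} to_sym"
  unfolding continuous_on_iff dist_sym_icc_def by (auto simp: to_sym_inverse)

lemma compact_UNIV_unit_icc: "compact (UNIV :: unit_icc set)"
proof -
  have "(UNIV :: unit_icc set) = to_unit ` {0..1}"
    by (metis UNIV_eq_I image_eqI of_unit of_unit_inverse)
  then show ?thesis
    using compact_continuous_image[OF continuous_on_to_unit] by simp
qed

lemma compact_UNIV_sym_icc: "compact (UNIV :: sym_icc set)"
proof -
  have "(UNIV :: sym_icc set) = to_sym ` {-1..1}"
    by (metis UNIV_eq_I image_eqI of_sym of_sym_inverse)
  then show ?thesis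
    using compact_continuous_image[OF continuous_on_to_sym] by simp
qed

lemma bcontfun_unit_icc:
  "(bcontfun :: (unit_icc \<Rightarrow> 'b::metric_space) set) = {f. continuous_on UNIV f}"
  unfolding bcontfun_def
  by (auto intro: compact_imp_bounded compact_continuous_image compact_UNIV_unit_icc)

lemma bcontfun_sym_icc:
  "(bcontfun :: (sym_icc \<Rightarrow> 'b::metric_space) set) = {f. continuous_on UNIV f}"
  unfolding bcontfun_def
  by (auto intro: compact_imp_bounded compact_continuous_image compact_UNIV_sym_icc)


section \<open>Wiener measure on paths started from 0 at time -1\<close>

definition C0_sym :: "(sym_icc \<Rightarrow>\<^sub>C real) set" where
  "C0_sym = {f. apply_bcontfun f (to_sym (-1)) = 0}"

definition coord :: "real \<Rightarrow> (sym_icc \<Rightarrow>\<^sub>C real) \<Rightarrow> real" where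
  "coord t f = apply_bcontfun f (to_sym t)"

definition brownian_motion_on ::
    "'a measure \<Rightarrow> real \<Rightarrow> real \<Rightarrow> (real \<Rightarrow> 'a \<Rightarrow> real) \<Rightarrow> bool" where
  "brownian_motion_on M a b B \<longleftrightarrow>
     prob_space M \<and>
     (\<forall>t\<in>{a..b}. B t \<in> borel_measurable M) \<and>
     (AE \<omega> in M. B a \<omega> = 0) \<and>
     (\<forall>n (t :: nat \<Rightarrow> real).
        (\<forall>i\<le>n. t i \<in> {a..b}) \<and> (\<forall>i<n. t i < t (Suc i)) \<longrightarrow>
        prob_space.indep_vars M (\<lambda>_. borel) (\<lambda>i \<omega>. B (t (Suc i)) \<omega> - B (t i) \<omega>) {..<n}) \<and>
     (\<forall>s\<in>{a..b}. \<forall>t\<in>{a..b}. s < t \<longrightarrow>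
        distributed M lborel (\<lambda>\<omega>. B t \<omega> - B s \<omega>) (normal_density 0 (sqrt (t - s)))) \<and>
     (AE \<omega> in M. continuous_on {a..b} (\<lambda>t. B t \<omega>))"

text \<open>The Borel \<sigma>-algebra of the subspace \<open>C0_sym\<close> is the trace of the Borel \<sigma>-algebra of
  C([-1,1]). The measure is not completed here; the completion is taken explicitly where it is
  used.\<close>

definition wiener_measure :: "(sym_icc \<Rightarrow>\<^sub>C real) measure \<Rightarrow> bool" where
  "wiener_measure W \<longleftrightarrow>
     sets W = sets (restrict_space borel C0_sym) \<and>
     brownian_motion_on W (-1) 1 coord"


section \<open>The frame process\<close>

text \<open>Only \<open>h \<in> {0..1}\<close> is meaningful, since then \<open>h - 1 + u \<in> {-1..1}\<close>.\<close>

definition frame :: "(sym_icc \<Rightarrow>\<^sub>C real) \<Rightarrow> real \<Rightarrow> (unit_icc \<Rightarrow>\<^sub>C real)" where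
  "frame f h = Bcontfun (\<lambda>u. apply_bcontfun f (to_sym (h - 1 + of_unit u)))"

lemma apply_frame:
  assumes "h \<in> {0..1}"
  shows "apply_bcontfun (frame f h) u = apply_bcontfun f (to_sym (h - 1 + of_unit u))"
proof -
  have *: "h - 1 + of_unit u \<in> {-1..1}" for u
    using of_unit[of u] assms by auto
  have "continuous_on UNIV (\<lambda>u. to_sym (h - 1 + of_unit u))"
    by (rule continuous_on_compose2[OF continuous_on_to_sym])
      (use * in \<open>auto intro!: continuous_intros\<close>)
  then have "continuous_on UNIV (\<lambda>u. apply_bcontfun f (to_sym (h - 1 + of_unit u)))"
    by (rule continuous_on_compose2[OF continuous_on_apply_bcontfun[of UNIV]]) auto
  then show ?thesis
    unfolding frame_def by (subst Bcontfun_inverse) (auto simp: bcontfun_unit_icc)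
qed


section \<open>Variation and dyadic polygonal approximation of Banach-valued paths\<close>

text \<open>A path [0,1] \<rightarrow> V is a function on \<open>real\<close> of which only the values on \<open>{0..1}\<close> matter.\<close>

definition dissections :: "(nat \<times> (nat \<Rightarrow> real)) set" where
  "dissections = {(n, t). t 0 = 0 \<and> t n = 1 \<and> (\<forall>i<n. t i < t (Suc i))}"

definition p_variation :: "real \<Rightarrow> (real \<Rightarrow> 'v::banach) \<Rightarrow> ennreal" where
  "p_variation q x =
     (SUP (n, t)\<in>dissections.
        ennreal ((\<Sum>i<n. norm (x (t (Suc i)) - x (t i)) powr q) powr (1 / q)))"

definition finite_p_variation :: "real \<Rightarrow> (real \<Rightarrow> 'v::banach) \<Rightarrow> bool" where
  "finite_p_variation q x \<longleftrightarrow> p_variation q x < \<infinity>"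

definition tendsto_p_variation ::
    "real \<Rightarrow> (nat \<Rightarrow> real \<Rightarrow> 'v::banach) \<Rightarrow> (real \<Rightarrow> 'v) \<Rightarrow> bool" where
  "tendsto_p_variation q xs x \<longleftrightarrow> (\<lambda>m. p_variation q (\<lambda>t. xs m t - x t)) \<longlonglongrightarrow> 0"

text \<open>The index \<open>k\<close> selects a dyadic interval \<open>[(k - 1) / 2 ^ m, k / 2 ^ m]\<close> with \<open>k \<ge> 1\<close>
  containing \<open>t\<close>; at the common endpoint of two such intervals the choice is immaterial.\<close>

definition dyadic_polygonal :: "nat \<Rightarrow> (real \<Rightarrow> 'v::banach) \<Rightarrow> real \<Rightarrow> 'v" where
  "dyadic_polygonal m X t =
     (let k = real_of_int (max 1 \<lceil>2 ^ m * t\<rceil>)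
      in X ((k - 1) / 2 ^ m) +
         (2 ^ m * (t - (k - 1) / 2 ^ m)) *\<^sub>R (X (k / 2 ^ m) - X ((k - 1) / 2 ^ m)))"

lemma dyadic_polygonal_eq:
  assumes "1 \<le> k" "(real k - 1) / 2 ^ m \<le> t" "t \<le> real k / 2 ^ m"
  shows "dyadic_polygonal m X t =
     X ((real k - 1) / 2 ^ m) +
     (2 ^ m * (t - (real k - 1) / 2 ^ m)) *\<^sub>R (X (real k / 2 ^ m) - X ((real k - 1) / 2 ^ m))"
proof -
  have le: "real k - 1 \<le> 2 ^ m * t" "2 ^ m * t \<le> real k"
    using assms by (auto simp: field_simps)
  show ?thesis
  proof (cases "2 ^ m * t = real k - 1 \<and> k \<noteq> 1")
    case True
    then have t: "t = (real k - 1) / 2 ^ m"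
      by (auto simp: field_simps)
    have "\<lceil>2 ^ m * t\<rceil> = int k - 1"
      using True by (simp add: ceiling_eq_iff)
    then have "max 1 \<lceil>2 ^ m * t\<rceil> = int k - 1"
      using True assms(1) by auto
    then have k: "real_of_int (max 1 \<lceil>2 ^ m * t\<rceil>) = real k - 1"
      by simp
    have "2 ^ m * (t - (real k - 1 - 1) / 2 ^ m) = (1 :: real)"
      unfolding t by (simp add: field_simps)
    then show ?thesis
      unfolding dyadic_polygonal_def Let_def k by (simp add: t)
  next
    case False
    have "max 1 \<lceil>2 ^ m * t\<rceil> = int k"
    proof (cases "2 ^ m * t = real k - 1")
      case True
      then show ?thesis using False by simp
    next
      case neq: False
      have "\<lceil>2 ^ m * t\<rceil> = int k"
        using le neq by (simp add: ceiling_eq_iff)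
      then show ?thesis using assms(1) by simp
    qed
    then have k: "real_of_int (max 1 \<lceil>2 ^ m * t\<rceil>) = real k"
      by simp
    show ?thesis
      unfolding dyadic_polygonal_def Let_def k ..
  qed
qed

end

theory Submission
  imports Defs
begin

text \<open>The supremum norm of a frame increment is a supremum of Brownian increments over one and the
  same time span, so every global Hoelder bound for the Brownian path is a Hoelder bound for the
  frame path, with the same exponent and constant (\<open>frame_Hoelder\<close>). For each \<open>\<gamma>\<close>
  between \<open>0\<close> and \<open>1/2\<close> the Brownian path is almost surely \<open>\<gamma>\<close>-Hoelder (\<open>Brownian_motion_Hoelder\<close>). From here on the
  argument is deterministic and concerns a \<open>\<gamma>\<close>-Hoelder path in an arbitrary Banach space, where
  \<open>1 / \<gamma>\<close> is chosen between \<open>2\<close> and \<open>p\<close>.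

  The key estimate is an interpolation (\<open>p_variation_le_of_Hoelder\<close>): with \<open>q = 1 / \<gamma>\<close>, the
  \<open>q\<close>-th power of an increment is at most a constant times the length of the time interval, so
  these powers sum to at most a constant, and the remaining factor is at most the oscillation of
  the path raised to the power \<open>p - q\<close>. For the path itself this gives finite \<open>p\<close>-variation.
  For convergence, apply it to the difference between the path and its \<open>m\<close>-th
  dyadic polygon: piecewise linear interpolation does not destroy the Hoelder bound, so
  the Hoelder constant of the difference is bounded uniformly in \<open>m\<close>, while its oscillation is at most
  of order \<open>2 powr (- m * \<gamma>)\<close>. As \<open>p > q\<close>, the bound tends to \<open>0\<close>.

  The Hoelder regularity of Brownian motion is the Kolmogorov--Chentsov argument: high moments of
  the Gaussian increments make the rescaled increments over all dyadic intervals of all levels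
  summable in expectation, hence almost surely bounded (\<open>AE_dyadic_increments_bounded\<close>), and a
  continuous function with such dyadic increments is Hoelder by chaining
  (\<open>Hoelder_of_dyadic_increments\<close>). The exceptional null sets depend on \<open>\<gamma>\<close>; only a sequence
  \<open>\<gamma> j \<longlonglongrightarrow> 1/2\<close> is needed to treat all \<open>p > 2\<close> at once.\<close>

section \<open>From dyadic increments to a Hoelder modulus\<close>

lemma dyadic_scale:
  fixes d :: real
  assumes "0 < d" "d \<le> 1"
  obtains n where "d \<le> (1/2) ^ n" "(1/2) ^ n < 2 * d"
proof -
  define n where "n = (LEAST n. (1/2::real) ^ n < 2 * d)"
  have "\<exists>n. (1/2::real) ^ n < 2 * d"
    using assms by (intro real_arch_pow_inv) auto
  then have n: "(1/2::real) ^ n < 2 * d"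
    unfolding n_def by (rule LeastI_ex)
  have "d \<le> (1/2) ^ n"
  proof (cases n)
    case (Suc m)
    then have "\<not> (1/2::real) ^ m < 2 * d"
      using not_less_Least[of m "\<lambda>n. (1/2::real) ^ n < 2 * d"] unfolding n_def by simp
    then show ?thesis using Suc by simp
  qed (use assms in simp)
  with n that show thesis by blast
qed

lemma power_powr_swap: "0 \<le> x \<Longrightarrow> (x ^ n) powr y = (x powr y) ^ n" for x y :: real
  by (induction n) (simp_all add: powr_mult)

text \<open>Chaining. Let \<open>d n t\<close> be \<open>t\<close> rounded down to the dyadic grid of level \<open>n\<close>. Going from
  \<open>d n t\<close> to \<open>d (n + 1) t\<close> moves by at most one cell of level \<open>n + 1\<close>, so by continuity \<open>f t\<close>
  differs from \<open>f (d n t)\<close> by a geometric tail of order \<open>2 powr (- n * \<gamma>)\<close>. If \<open>2 powr - n\<close> is comparable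
  with \<open>t - s\<close>, then \<open>d n s\<close> and \<open>d n t\<close> are equal or neighbours, and three terms of this order
  remain. The endpoints are integers so that they lie on every dyadic grid, and \<open>t - s\<close> is at most
  \<open>1\<close> because the coarsest grid has mesh \<open>1\<close>.\<close>

lemma Hoelder_of_dyadic_increments:
  fixes f :: "real \<Rightarrow> 'b::real_normed_vector" and a b :: int
  assumes cont: "continuous_on {of_int a..of_int b} f"
    and \<gamma>: "0 < \<gamma>" and C: "0 \<le> C"
    and incr: "\<And>n k. a * 2 ^ n \<le> k \<Longrightarrow> k < b * 2 ^ n \<Longrightarrow>
      norm (f (of_int (k + 1) / 2 ^ n) - f (of_int k / 2 ^ n)) \<le> C * (2 powr - \<gamma>) ^ n"
  obtains K where "0 \<le> K"
    "\<And>s t. of_int a \<le> s \<Longrightarrow> s \<le> t \<Longrightarrow> t \<le> of_int b \<Longrightarrow> t \<le> s + 1 \<Longrightarrow>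
      norm (f t - f s) \<le> K * (t - s) powr \<gamma>"
proof -
  define \<rho> :: real where "\<rho> = 2 powr - \<gamma>"
  have \<rho>: "0 < \<rho>" "\<rho> < 1"
    using \<gamma> by (auto simp: \<rho>_def powr_less_one)
  have \<rho>_eq: "\<rho> = (1/2) powr \<gamma>"
    by (simp add: \<rho>_def powr_divide powr_minus_divide)
  define d :: "nat \<Rightarrow> real \<Rightarrow> real" where "d n t = of_int \<lfloor>2 ^ n * t\<rfloor> / 2 ^ n" for n t
  have d_mem: "d n t \<in> {of_int a..of_int b}" if t: "t \<in> {of_int a..of_int b}" for n t
  proof -
    have "of_int (a * 2 ^ n) \<le> 2 ^ n * t" using t by (simp add: mult.commute)
    then have "a * 2 ^ n \<le> \<lfloor>2 ^ n * t\<rfloor>" by (simp only: le_floor_iff)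
    then have "real_of_int (a * 2 ^ n) \<le> real_of_int \<lfloor>2 ^ n * t\<rfloor>" by (simp only: of_int_le_iff)
    then have 1: "of_int a * 2 ^ n \<le> real_of_int \<lfloor>2 ^ n * t\<rfloor>" by simp
    have "real_of_int \<lfloor>2 ^ n * t\<rfloor> \<le> 2 ^ n * t" by (rule of_int_floor_le)
    also have "\<dots> \<le> of_int b * 2 ^ n" using t by (simp add: mult.commute)
    finally show ?thesis using 1 by (simp add: d_def field_simps)
  qed
  have d_le: "d n t \<le> t" for n t
    using of_int_floor_le[of "2 ^ n * t"] by (simp add: d_def field_simps)
  have d_gt: "t - (1/2) ^ n < d n t" for n t
  proof -
    have "2 ^ n * t < real_of_int \<lfloor>2 ^ n * t\<rfloor> + 1" by linarith
    then have "t < (real_of_int \<lfloor>2 ^ n * t\<rfloor> + 1) / 2 ^ n"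
      by (simp add: pos_less_divide_eq mult.commute)
    then show ?thesis by (simp add: d_def add_divide_distrib power_one_over)
  qed
  have adj: "norm (f (of_int (k + 1) / 2 ^ n) - f (of_int k / 2 ^ n)) \<le> C * \<rho> ^ n"
    if "of_int k / 2 ^ n \<in> {real_of_int a..of_int b}" "of_int (k + 1) / 2 ^ n \<in> {real_of_int a..of_int b}" for k n
  proof -
    have "real_of_int (a * 2 ^ n) \<le> of_int k" "real_of_int (k + 1) \<le> of_int (b * 2 ^ n)"
      using that by (auto simp: field_simps)
    then have "a * 2 ^ n \<le> k" "k < b * 2 ^ n"
      unfolding of_int_le_iff by auto
    then show ?thesis using incr unfolding \<rho>_def by blast
  qed
  have step: "norm (f (d (Suc n) t) - f (d n t)) \<le> C * \<rho> ^ Suc n"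
    if t: "t \<in> {of_int a..of_int b}" for n t
  proof -
    have "\<lfloor>2 ^ Suc n * t\<rfloor> = 2 * \<lfloor>2 ^ n * t\<rfloor> \<or> \<lfloor>2 ^ Suc n * t\<rfloor> = 2 * \<lfloor>2 ^ n * t\<rfloor> + 1"
      unfolding power_Suc mult.assoc by linarith
    then show ?thesis
    proof
      assume "\<lfloor>2 ^ Suc n * t\<rfloor> = 2 * \<lfloor>2 ^ n * t\<rfloor>"
      then have "d (Suc n) t = d n t" by (simp add: d_def)
      then show ?thesis using C \<rho> by simp
    next
      assume *: "\<lfloor>2 ^ Suc n * t\<rfloor> = 2 * \<lfloor>2 ^ n * t\<rfloor> + 1"
      have 1: "d n t = of_int (2 * \<lfloor>2 ^ n * t\<rfloor>) / 2 ^ Suc n" by (simp add: d_def)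
      have 2: "d (Suc n) t = of_int (2 * \<lfloor>2 ^ n * t\<rfloor> + 1) / 2 ^ Suc n"
        unfolding d_def * ..
      show ?thesis
        using adj[of "2 * \<lfloor>2 ^ n * t\<rfloor>" "Suc n"] d_mem[OF t, of n] d_mem[OF t, of "Suc n"]
        unfolding 1 2 by blast
    qed
  qed
  have chain: "norm (f (d (n + m) t) - f (d n t)) \<le> C * \<rho> ^ n * (1 - \<rho> ^ m) / (1 - \<rho>)"
    if t: "t \<in> {of_int a..of_int b}" for n m t
  proof (induction m)
    case (Suc m)
    have "norm (f (d (n + Suc m) t) - f (d n t))
        \<le> norm (f (d (Suc (n + m)) t) - f (d (n + m) t)) + norm (f (d (n + m) t) - f (d n t))"
      using norm_triangle_ineq[of "f (d (Suc (n + m)) t) - f (d (n + m) t)" "f (d (n + m) t) - f (d n t)"]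
      by simp
    also have "\<dots> \<le> C * \<rho> ^ (n + m) + C * \<rho> ^ n * (1 - \<rho> ^ m) / (1 - \<rho>)"
    proof (intro add_mono Suc)
      have "C * \<rho> ^ Suc (n + m) \<le> C * \<rho> ^ (n + m)"
        using \<rho> C by (intro mult_left_mono power_decreasing) auto
      with step[OF t, of "n + m"]
      show "norm (f (d (Suc (n + m)) t) - f (d (n + m) t)) \<le> C * \<rho> ^ (n + m)" by linarith
    qed
    also have "\<dots> = C * \<rho> ^ n * (1 - \<rho> ^ Suc m) / (1 - \<rho>)"
      using \<rho> by (simp add: field_simps power_add)
    finally show ?case .
  qed simp
  have tail: "norm (f t - f (d n t)) \<le> C * \<rho> ^ n / (1 - \<rho>)"
    if t: "t \<in> {of_int a..of_int b}" for n t
  proof -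
    have "(\<lambda>m. d (n + m) t) \<longlonglongrightarrow> t"
    proof (rule tendsto_sandwich)
      have "(\<lambda>m. t - (1/2) ^ (n + m)) \<longlonglongrightarrow> t - (1/2) ^ n * 0"
        unfolding power_add by (intro tendsto_intros LIMSEQ_power_zero) auto
      then show "(\<lambda>m. t - (1/2) ^ (n + m)) \<longlonglongrightarrow> t" by simp
    qed (use d_le d_gt[THEN less_imp_le] in auto)
    then have "(\<lambda>m. f (d (n + m) t)) \<longlonglongrightarrow> f t"
      by (rule continuous_on_tendsto_compose[OF cont]) (use t d_mem in auto)
    then have "(\<lambda>m. norm (f (d (n + m) t) - f (d n t))) \<longlonglongrightarrow> norm (f t - f (d n t))"
      by (intro tendsto_intros)
    moreover have "norm (f (d (n + m) t) - f (d n t)) \<le> C * \<rho> ^ n / (1 - \<rho>)" for m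
    proof -
      have "C * \<rho> ^ n * (1 - \<rho> ^ m) \<le> C * \<rho> ^ n * 1"
        using \<rho> C by (intro mult_left_mono) auto
      then have "C * \<rho> ^ n * (1 - \<rho> ^ m) / (1 - \<rho>) \<le> C * \<rho> ^ n / (1 - \<rho>)"
        using \<rho> by (intro divide_right_mono) auto
      with chain[OF t, of n m] show ?thesis by linarith
    qed
    ultimately show ?thesis by (intro Lim_bounded) auto
  qed
  \<comment> \<open>Two tails and one grid increment; the factor \<open>2 powr \<gamma>\<close> is lost when the
    mesh of the grid is replaced by \<open>t - s\<close>, which may be nearly half as large.\<close>
  define K where "K = C * (2 / (1 - \<rho>) + 1) * 2 powr \<gamma>"
  have "norm (f t - f s) \<le> K * (t - s) powr \<gamma>"
    if st: "of_int a \<le> s" "s \<le> t" "t \<le> of_int b" "t \<le> s + 1" for s t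
  proof (cases "s = t")
    case False
    obtain n where n: "t - s \<le> (1/2) ^ n" "(1/2) ^ n < 2 * (t - s)"
      using dyadic_scale[of "t - s"] st False by auto
    have mem: "s \<in> {of_int a..of_int b}" "t \<in> {of_int a..of_int b}" using st by auto
    have mid: "norm (f (d n t) - f (d n s)) \<le> C * \<rho> ^ n"
    proof -
      have "2 ^ n * t \<le> 2 ^ n * s + 1" "2 ^ n * s \<le> 2 ^ n * t"
        using n(1) st(2) by (auto simp: field_simps power_divide)
      then have "\<lfloor>2 ^ n * t\<rfloor> = \<lfloor>2 ^ n * s\<rfloor> \<or> \<lfloor>2 ^ n * t\<rfloor> = \<lfloor>2 ^ n * s\<rfloor> + 1"
        by linarith
      then show ?thesis
      proof
        assume "\<lfloor>2 ^ n * t\<rfloor> = \<lfloor>2 ^ n * s\<rfloor>"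
        then show ?thesis using C \<rho> by (simp add: d_def)
      next
        assume "\<lfloor>2 ^ n * t\<rfloor> = \<lfloor>2 ^ n * s\<rfloor> + 1"
        then show ?thesis
          using adj[of "\<lfloor>2 ^ n * s\<rfloor>" n] d_mem[OF mem(1), of n] d_mem[OF mem(2), of n]
          unfolding d_def by simp
      qed
    qed
    have "f t - f s = (f t - f (d n t)) + (f (d n t) - f (d n s)) - (f s - f (d n s))" by simp
    then have "norm (f t - f s) \<le> norm (f t - f (d n t)) + norm (f (d n t) - f (d n s)) + norm (f s - f (d n s))"
      using norm_triangle_ineq4[of "(f t - f (d n t)) + (f (d n t) - f (d n s))" "f s - f (d n s)"]
        norm_triangle_ineq[of "f t - f (d n t)" "f (d n t) - f (d n s)"] by simp
    also have "\<dots> \<le> C * \<rho> ^ n / (1 - \<rho>) + C * \<rho> ^ n + C * \<rho> ^ n / (1 - \<rho>)"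
      by (intro add_mono tail mid mem)
    also have "\<dots> = C * (2 / (1 - \<rho>) + 1) * \<rho> ^ n"
      by (simp add: algebra_simps)
    also have "\<rho> ^ n = ((1/2) ^ n) powr \<gamma>"
      by (simp add: \<rho>_eq power_powr_swap)
    also have "C * (2 / (1 - \<rho>) + 1) * ((1/2) ^ n) powr \<gamma> \<le> C * (2 / (1 - \<rho>) + 1) * (2 * (t - s)) powr \<gamma>"
      using n \<gamma> C \<rho> by (intro mult_left_mono powr_mono2) auto
    also have "\<dots> = K * (t - s) powr \<gamma>"
      using st by (simp add: K_def powr_mult del: right_diff_distrib_numeral)
    finally show ?thesis .
  qed simp
  moreover have "0 \<le> K" using C \<rho> by (simp add: K_def)
  ultimately show thesis using that by blast
qed

section \<open>Moment bounds and the Kolmogorov--Chentsov argument\<close>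

text \<open>Level \<open>n\<close> has \<open>(b - a) * 2 ^ n\<close> cells, and the \<open>\<alpha>\<close>-th moment of an increment over one of
  them, divided by the \<open>\<alpha>\<close>-th power of the claimed bound \<open>2 powr (- n * \<gamma>)\<close>, is at most
  \<open>c * 2 powr (n * (\<gamma> * \<alpha> - \<beta> - 1))\<close>. Hence the sum of the rescaled moments over all cells of all
  levels is at most a geometric series, convergent because \<open>\<gamma> * \<alpha> < \<beta>\<close>. The random variable \<open>S\<close> summing the rescaled powers is
  thus almost surely finite, and each single term is at most \<open>S\<close>. Working with this one
  sum in place of the Borel--Cantelli lemma yields a constant valid for every level, not only for
  large ones.\<close>

lemma AE_dyadic_increments_bounded:
  fixes X :: "real \<Rightarrow> 'a \<Rightarrow> 'b::{real_normed_vector, second_countable_topology}" and a b :: int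
  assumes meas: "\<And>t. t \<in> {of_int a..of_int b} \<Longrightarrow> X t \<in> borel_measurable M"
    and \<alpha>: "0 < \<alpha>" and c: "0 \<le> c" and \<gamma>: "\<gamma> * \<alpha> < \<beta>"
    and moment: "\<And>s t. of_int a \<le> s \<Longrightarrow> s < t \<Longrightarrow> t \<le> of_int b \<Longrightarrow>
      (\<integral>\<^sup>+\<omega>. ennreal (norm (X t \<omega> - X s \<omega>) powr \<alpha>) \<partial>M) \<le> ennreal (c * (t - s) powr (1 + \<beta>))"
  shows "AE \<omega> in M. \<exists>C\<ge>0. \<forall>n k. a * 2 ^ n \<le> k \<longrightarrow> k < b * 2 ^ n \<longrightarrow>
    norm (X (of_int (k + 1) / 2 ^ n) \<omega> - X (of_int k / 2 ^ n) \<omega>) \<le> C * (2 powr - \<gamma>) ^ n"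
proof -
  define I where "I n = {a * 2 ^ n..<b * 2 ^ n}" for n :: nat
  define D where "D n k \<omega> = norm (X (of_int (k + 1) / 2 ^ n) \<omega> - X (of_int k / 2 ^ n) \<omega>) / (2 powr - \<gamma>) ^ n"
    for n :: nat and k :: int and \<omega>
  have mem: "of_int a \<le> real_of_int k / 2 ^ n" "real_of_int k / 2 ^ n < of_int (k + 1) / 2 ^ n"
    "of_int (k + 1) / 2 ^ n \<le> real_of_int b" if "k \<in> I n" for k n
  proof -
    have "a * 2 ^ n \<le> k" "k + 1 \<le> b * 2 ^ n" using that by (auto simp: I_def)
    then have "real_of_int (a * 2 ^ n) \<le> of_int k" "real_of_int (k + 1) \<le> of_int (b * 2 ^ n)"
      by (simp_all only: of_int_le_iff)
    then show "of_int a \<le> real_of_int k / 2 ^ n" "real_of_int k / 2 ^ n < of_int (k + 1) / 2 ^ n"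
    "of_int (k + 1) / 2 ^ n \<le> real_of_int b" by (auto simp: field_simps)
  qed
  have D_meas[measurable]: "D n k \<in> borel_measurable M" if "k \<in> I n" for n k
  proof -
    have [measurable]: "X (of_int k / 2 ^ n) \<in> borel_measurable M" "X (of_int (k + 1) / 2 ^ n) \<in> borel_measurable M"
      using mem[OF that] by (auto intro!: meas)
    show ?thesis unfolding D_def by measurable
  qed
  define S where "S \<omega> = (\<Sum>n. \<Sum>k\<in>I n. ennreal (D n k \<omega> powr \<alpha>))" for \<omega>
  have S_meas[measurable]: "S \<in> borel_measurable M"
    unfolding S_def by measurable
  define r where "r = 2 powr (\<gamma> * \<alpha> - \<beta>)"
  have r: "0 < r" "r < 1" using \<gamma> by (auto simp: r_def powr_less_one)
  have one: "(\<integral>\<^sup>+\<omega>. ennreal (D n k \<omega> powr \<alpha>) \<partial>M) \<le> ennreal (c * r ^ n / 2 ^ n)" if k: "k \<in> I n" for n k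
  proof -
    let ?N = "\<lambda>\<omega>. norm (X (of_int (k + 1) / 2 ^ n) \<omega> - X (of_int k / 2 ^ n) \<omega>) powr \<alpha>"
    have [measurable]: "X (of_int k / 2 ^ n) \<in> borel_measurable M" "X (of_int (k + 1) / 2 ^ n) \<in> borel_measurable M"
      using mem[OF k] by (auto intro!: meas)
    have len: "real_of_int (k + 1) / 2 ^ n - of_int k / 2 ^ n = 1 / 2 ^ n"
      by (simp add: field_simps)
    have "((2 powr - \<gamma>) ^ n) powr \<alpha> = 2 powr - (\<gamma> * \<alpha> * n)"
      by (simp add: powr_power powr_powr mult_ac)
    then have sc: "1 / ((2 powr - \<gamma>) ^ n) powr \<alpha> = 2 powr (\<gamma> * \<alpha> * n)"
      by (simp only:) (simp add: powr_minus divide_inverse)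
    have "(\<integral>\<^sup>+\<omega>. ennreal (D n k \<omega> powr \<alpha>) \<partial>M) = (\<integral>\<^sup>+\<omega>. ennreal (2 powr (\<gamma> * \<alpha> * n)) * ennreal (?N \<omega>) \<partial>M)"
    proof (intro nn_integral_cong)
      fix \<omega>
      have "D n k \<omega> powr \<alpha> = 2 powr (\<gamma> * \<alpha> * n) * ?N \<omega>"
        unfolding D_def by (subst powr_divide) (auto simp flip: sc)
      then show "ennreal (D n k \<omega> powr \<alpha>) = ennreal (2 powr (\<gamma> * \<alpha> * n)) * ennreal (?N \<omega>)"
        by (simp add: ennreal_mult)
    qed
    also have "\<dots> = ennreal (2 powr (\<gamma> * \<alpha> * n)) * (\<integral>\<^sup>+\<omega>. ennreal (?N \<omega>) \<partial>M)"
      by (intro nn_integral_cmult) measurable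
    also have "\<dots> \<le> ennreal (2 powr (\<gamma> * \<alpha> * n)) * ennreal (c * (1 / 2 ^ n) powr (1 + \<beta>))"
      using moment[OF mem[OF k]] unfolding len by (intro mult_left_mono) auto
    also have "\<dots> = ennreal (2 powr (\<gamma> * \<alpha> * n) * (c * (1 / 2 ^ n) powr (1 + \<beta>)))"
      using c by (simp add: ennreal_mult)
    also have "2 powr (\<gamma> * \<alpha> * n) * (c * (1 / 2 ^ n) powr (1 + \<beta>)) = c * r ^ n / 2 ^ n"
    proof -
      have half: "(1 / 2 ^ n::real) = 2 powr (- real n)"
        by (simp add: powr_minus powr_realpow divide_inverse)
      moreover have "(1 / 2 ^ n) powr (1 + \<beta>) = 2 powr (- real n * (1 + \<beta>))"
        unfolding half by (rule powr_powr)
      moreover have "r ^ n = 2 powr ((\<gamma> * \<alpha> - \<beta>) * n)"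
        by (simp add: r_def powr_power mult.commute)
      ultimately have "2 powr (\<gamma> * \<alpha> * n) * (1 / 2 ^ n) powr (1 + \<beta>) = r ^ n * (1 / 2 ^ n)"
        by (simp add: algebra_simps flip: powr_add)
      then show ?thesis by (simp add: mult_ac)
    qed
    finally show ?thesis .
  qed
  have level: "(\<Sum>k\<in>I n. \<integral>\<^sup>+\<omega>. ennreal (D n k \<omega> powr \<alpha>) \<partial>M) \<le> ennreal (c * nat (b - a) * r ^ n)" for n
  proof -
    have "(\<Sum>k\<in>I n. \<integral>\<^sup>+\<omega>. ennreal (D n k \<omega> powr \<alpha>) \<partial>M) \<le> (\<Sum>k\<in>I n. ennreal (c * r ^ n / 2 ^ n))"
      by (intro sum_mono one)
    also have "\<dots> = ennreal (card (I n) * (c * r ^ n / 2 ^ n))"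
      using c r by (simp add: ennreal_of_nat_eq_real_of_nat flip: ennreal_mult)
    also have "card (I n) = nat (b - a) * 2 ^ n"
    proof -
      have "card (I n) = nat (2 ^ n * (b - a))" by (simp add: I_def algebra_simps)
      also have "\<dots> = nat (2 ^ n) * nat (b - a)" by (rule nat_mult_distrib) simp
      finally show ?thesis by (simp add: nat_power_eq)
    qed
    also have "real (nat (b - a) * 2 ^ n) * (c * r ^ n / 2 ^ n) = c * nat (b - a) * r ^ n"
      by simp
    finally show ?thesis by simp
  qed
  have "(\<integral>\<^sup>+\<omega>. S \<omega> \<partial>M) = (\<Sum>n. \<Sum>k\<in>I n. \<integral>\<^sup>+\<omega>. ennreal (D n k \<omega> powr \<alpha>) \<partial>M)"
    unfolding S_def by (subst nn_integral_suminf) (auto simp del: sum_ennreal intro!: suminf_cong nn_integral_sum)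
  also have "\<dots> \<le> (\<Sum>n. ennreal (c * nat (b - a) * r ^ n))"
    by (intro suminf_le level) auto
  also have "\<dots> < \<infinity>"
    using r c by (subst suminf_ennreal2) (auto intro!: summable_mult)
  finally have "AE \<omega> in M. S \<omega> \<noteq> \<infinity>"
    by (intro nn_integral_noteq_infinite) auto
  then show ?thesis
  proof eventually_elim
    case (elim \<omega>)
    define C where "C = enn2real (S \<omega>) powr (1 / \<alpha>)"
    have "norm (X (of_int (k + 1) / 2 ^ n) \<omega> - X (of_int k / 2 ^ n) \<omega>) \<le> C * (2 powr - \<gamma>) ^ n"
      if "a * 2 ^ n \<le> k" "k < b * 2 ^ n" for n k
    proof -
      have k: "k \<in> I n" using that by (simp add: I_def)
      have D0: "0 \<le> D n k \<omega>" by (simp add: D_def)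
      have "ennreal (D n k \<omega> powr \<alpha>) \<le> (\<Sum>k\<in>I n. ennreal (D n k \<omega> powr \<alpha>))"
        using k by (intro member_le_sum) (auto simp: I_def)
      also have "\<dots> = (\<Sum>n\<in>{n}. \<Sum>k\<in>I n. ennreal (D n k \<omega> powr \<alpha>))" by simp
      also have "\<dots> \<le> S \<omega>"
        unfolding S_def by (intro sum_le_suminf) auto
      also have "\<dots> = ennreal (enn2real (S \<omega>))"
        using elim by (simp add: less_top)
      finally have "D n k \<omega> powr \<alpha> \<le> enn2real (S \<omega>)"
        by simp
      then have "(D n k \<omega> powr \<alpha>) powr (1 / \<alpha>) \<le> C"
        unfolding C_def using \<alpha> by (intro powr_mono2) auto
      then have "D n k \<omega> \<le> C"
        using \<alpha> D0 by (simp add: powr_powr)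
      then show ?thesis
        unfolding D_def by (simp add: pos_divide_le_eq)
    qed
    then show ?case by (intro exI[of _ C]) (auto simp: C_def)
  qed
qed

text \<open>The factor \<open>(\<sigma>\<^sup>2) ^ r\<close> is what matters: for Brownian increments \<open>\<sigma>\<^sup>2\<close> is the time
  difference, so moments of high order gain a high power of it.\<close>

lemma nn_integral_normal_even_power:
  assumes X: "distributed M lborel X (normal_density 0 \<sigma>)" and \<sigma>: "0 < \<sigma>" and r: "0 < r"
  shows "(\<integral>\<^sup>+\<omega>. ennreal (\<bar>X \<omega>\<bar> powr (2 * real r)) \<partial>M) = ennreal (fact (2 * r) / (2 ^ r * fact r) * (\<sigma>\<^sup>2) ^ r)"
proof -
  have "(\<integral>\<^sup>+\<omega>. ennreal (\<bar>X \<omega>\<bar> powr (2 * real r)) \<partial>M) =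
      (\<integral>\<^sup>+x. ennreal (normal_density 0 \<sigma> x) * ennreal (\<bar>x\<bar> powr (2 * real r)) \<partial>lborel)"
    by (rule distributed_nn_integral[OF X, symmetric]) simp
  also have "\<dots> = (\<integral>\<^sup>+x. ennreal (normal_density 0 \<sigma> x * (x - 0) ^ (2 * r)) \<partial>lborel)"
  proof (intro nn_integral_cong)
    fix x :: real
    have "\<bar>x\<bar> powr (2 * real r) = x ^ (2 * r)"
      using r powr_realpow[of "\<bar>x\<bar>" "2 * r"] by (cases "x = 0") (auto simp: power_even_abs)
    then show "ennreal (normal_density 0 \<sigma> x) * ennreal (\<bar>x\<bar> powr (2 * real r)) = ennreal (normal_density 0 \<sigma> x * (x - 0) ^ (2 * r))"
      by (simp add: ennreal_mult)
  qed
  also have "\<dots> = ennreal (fact (2 * r) / ((2 / \<sigma>\<^sup>2) ^ r * fact r))"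
    using normal_moment_even[OF \<sigma>, of 0 r]
    by (intro nn_integral_eq_integrable[THEN iffD2]) (auto simp: has_bochner_integral_iff)
  also have "fact (2 * r) / ((2 / \<sigma>\<^sup>2) ^ r * fact r) = fact (2 * r) / (2 ^ r * fact r) * (\<sigma>\<^sup>2) ^ r"
    using \<sigma> by (simp add: power_divide)
  finally show ?thesis .
qed

text \<open>The moment of order \<open>2 * r\<close> scales like \<open>(t - s) ^ r\<close>, which in the Kolmogorov--Chentsov
  argument permits every exponent below \<open>(r - 1) / (2 * r)\<close>; this tends to \<open>1/2\<close> as \<open>r\<close> grows.\<close>

lemma Brownian_motion_Hoelder:
  fixes a b :: int
  assumes B: "brownian_motion_on M (of_int a) (of_int b) B" and \<gamma>: "0 < \<gamma>" "\<gamma> < 1/2"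
  shows "AE \<omega> in M. \<exists>K\<ge>0. \<forall>s t. of_int a \<le> s \<longrightarrow> s \<le> t \<longrightarrow> t \<le> of_int b \<longrightarrow> t \<le> s + 1 \<longrightarrow>
    \<bar>B t \<omega> - B s \<omega>\<bar> \<le> K * (t - s) powr \<gamma>"
proof -
  \<comment> \<open>This is the condition \<open>\<gamma> < (r - 1) / (2 * r)\<close>, solved for \<open>r\<close>.\<close>
  obtain r :: nat where "1 / (1 - 2 * \<gamma>) < r"
    using reals_Archimedean2 by blast
  then have r: "1 < r * (1 - 2 * \<gamma>)" using \<gamma> by (simp add: field_simps)
  then have r0: "0 < r" by (cases r) auto
  have "AE \<omega> in M. \<exists>C\<ge>0. \<forall>n k. a * 2 ^ n \<le> k \<longrightarrow> k < b * 2 ^ n \<longrightarrow>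
    norm (B (of_int (k + 1) / 2 ^ n) \<omega> - B (of_int k / 2 ^ n) \<omega>) \<le> C * (2 powr - \<gamma>) ^ n"
  proof (rule AE_dyadic_increments_bounded)
    show "\<gamma> * (2 * real r) < real r - 1" using r by (simp add: algebra_simps)
    show "0 \<le> (fact (2 * r) / (2 ^ r * fact r) :: real)" by simp
    fix s t :: real assume st: "of_int a \<le> s" "s < t" "t \<le> of_int b"
    then have "distributed M lborel (\<lambda>\<omega>. B t \<omega> - B s \<omega>) (normal_density 0 (sqrt (t - s)))"
      using B unfolding brownian_motion_on_def by auto
    from nn_integral_normal_even_power[OF this _ r0]
    show "(\<integral>\<^sup>+\<omega>. ennreal (norm (B t \<omega> - B s \<omega>) powr (2 * real r)) \<partial>M)
      \<le> ennreal (fact (2 * r) / (2 ^ r * fact r) * (t - s) powr (1 + (real r - 1)))"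
      using st by (simp add: powr_realpow)
  qed (use B r0 in \<open>auto simp: brownian_motion_on_def\<close>)
  moreover have "AE \<omega> in M. continuous_on {of_int a..of_int b} (\<lambda>t. B t \<omega>)"
    using B by (simp add: brownian_motion_on_def)
  ultimately show ?thesis
  proof eventually_elim
    case (elim \<omega>)
    then obtain C where "0 \<le> C" "\<And>n k. a * 2 ^ n \<le> k \<Longrightarrow> k < b * 2 ^ n \<Longrightarrow>
      norm (B (of_int (k + 1) / 2 ^ n) \<omega> - B (of_int k / 2 ^ n) \<omega>) \<le> C * (2 powr - \<gamma>) ^ n" by blast
    from Hoelder_of_dyadic_increments[OF elim(2) \<gamma>(1) this]
    obtain K where "0 \<le> K" "\<And>s t. of_int a \<le> s \<Longrightarrow> s \<le> t \<Longrightarrow> t \<le> of_int b \<Longrightarrow> t \<le> s + 1 \<Longrightarrow>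
      norm (B t \<omega> - B s \<omega>) \<le> K * (t - s) powr \<gamma>" by blast
    then show ?case by (intro exI[of _ K]) auto
  qed
qed

section \<open>Variation of Hoelder paths and of their dyadic polygons\<close>

text \<open>Write \<open>q = 1 / \<gamma>\<close> and split the \<open>p\<close>-th power of an increment into a power \<open>p - q\<close>, at most
  \<open>\<delta> powr (p - q)\<close>, and a power \<open>q\<close>, which the Hoelder bound turns into \<open>K powr q\<close> times the
  length of the time step. The time steps of a dissection add up to \<open>1\<close>.\<close>

lemma p_variation_le_of_Hoelder:
  fixes x :: "real \<Rightarrow> 'v::banach"
  assumes \<gamma>: "0 < \<gamma>" "1 / \<gamma> \<le> p" and K: "0 \<le> K"
    and hoelder: "\<And>s t. 0 \<le> s \<Longrightarrow> s \<le> t \<Longrightarrow> t \<le> 1 \<Longrightarrow> norm (x t - x s) \<le> K * (t - s) powr \<gamma>"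
    and osc: "\<And>s t. 0 \<le> s \<Longrightarrow> s \<le> t \<Longrightarrow> t \<le> 1 \<Longrightarrow> norm (x t - x s) \<le> \<delta>"
  shows "p_variation p x \<le> ennreal ((\<delta> powr (p - 1 / \<gamma>) * K powr (1 / \<gamma>)) powr (1 / p))"
  unfolding p_variation_def
proof (intro SUP_least, clarify)
  fix n :: nat and t :: "nat \<Rightarrow> real" assume "(n, t) \<in> dissections"
  then have t: "t 0 = 0" "t n = 1" "\<And>i. i < n \<Longrightarrow> t i < t (Suc i)"
    by (auto simp: dissections_def)
  have mono: "t i \<le> t j" if "i \<le> j" "j \<le> n" for i j
    using that
  proof (induction j rule: dec_induct)
    case (step j)
    then show ?case using t(3)[of j] by auto
  qed simp
  have p: "0 < p" using \<gamma> by (smt (verit) divide_pos_pos)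
  have "norm (x (t (Suc i)) - x (t i)) powr p \<le> \<delta> powr (p - 1 / \<gamma>) * K powr (1 / \<gamma>) * (t (Suc i) - t i)"
    if i: "i < n" for i
  proof -
    let ?N = "norm (x (t (Suc i)) - x (t i))"
    have mem: "0 \<le> t i" "t i \<le> t (Suc i)" "t (Suc i) \<le> 1"
      using mono[of 0 i] mono[of i "Suc i"] mono[of "Suc i" n] i t(1,2) by auto
    have "?N powr p = ?N powr (p - 1 / \<gamma>) * ?N powr (1 / \<gamma>)"
      by (simp flip: powr_add)
    also have "\<dots> \<le> \<delta> powr (p - 1 / \<gamma>) * (K * (t (Suc i) - t i) powr \<gamma>) powr (1 / \<gamma>)"
      using \<gamma> hoelder[OF mem] osc[OF mem] by (intro mult_mono powr_mono2) auto
    also have "(K * (t (Suc i) - t i) powr \<gamma>) powr (1 / \<gamma>) = K powr (1 / \<gamma>) * (t (Suc i) - t i)"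
      using K \<gamma> mem by (simp add: powr_mult powr_powr)
    finally show ?thesis by (simp add: mult_ac)
  qed
  then have "(\<Sum>i<n. norm (x (t (Suc i)) - x (t i)) powr p)
      \<le> (\<Sum>i<n. \<delta> powr (p - 1 / \<gamma>) * K powr (1 / \<gamma>) * (t (Suc i) - t i))"
    by (intro sum_mono) auto
  also have "\<dots> = \<delta> powr (p - 1 / \<gamma>) * K powr (1 / \<gamma>)"
    by (simp add: t sum_lessThan_telescope flip: sum_distrib_left)
  finally show "ennreal ((\<Sum>i<n. norm (x (t (Suc i)) - x (t i)) powr p) powr (1 / p))
      \<le> ennreal ((\<delta> powr (p - 1 / \<gamma>) * K powr (1 / \<gamma>)) powr (1 / p))"
    using p by (intro ennreal_leI powr_mono2 sum_nonneg) auto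
qed

lemma dyadic_index:
  assumes "0 \<le> t" "t \<le> (1::real)"
  obtains k :: nat where "1 \<le> k" "(real k - 1) / 2 ^ m \<le> t" "t \<le> real k / 2 ^ m" "real k / 2 ^ m \<le> 1"
proof -
  define k where "k = nat (max 1 \<lceil>2 ^ m * t\<rceil>)"
  have k: "real k = max 1 (of_int \<lceil>2 ^ m * t\<rceil>)" by (simp add: k_def of_nat_nat)
  have "2 ^ m * t \<le> 2 ^ m" using assms by simp
  then have "\<lceil>2 ^ m * t\<rceil> \<le> 2 ^ m" by (simp add: ceiling_le_iff)
  then have "real_of_int \<lceil>2 ^ m * t\<rceil> \<le> real_of_int (2 ^ m)" by (simp only: of_int_le_iff)
  then have "real k \<le> 2 ^ m" by (simp add: k)
  moreover have "real k - 1 \<le> 2 ^ m * t"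
    unfolding k using assms by (auto simp: max_def)
  moreover have "2 ^ m * t \<le> real k" unfolding k by linarith
  moreover have "1 \<le> k" by (simp add: k_def)
  ultimately show thesis by (intro that[of k]) (auto simp: field_simps)
qed

context
  fixes X :: "real \<Rightarrow> 'v::banach" and \<gamma> K :: real
  assumes \<gamma>: "0 < \<gamma>" "\<gamma> \<le> 1" and K: "0 \<le> K"
    and hoelder: "\<And>s t. 0 \<le> s \<Longrightarrow> s \<le> t \<Longrightarrow> t \<le> 1 \<Longrightarrow> norm (X t - X s) \<le> K * (t - s) powr \<gamma>"
begin

text \<open>On a cell the polygon is affine with slope at most \<open>K * 2 ^ m * (2 powr - m) powr \<gamma>\<close>. The
  fraction \<open>v = 2 ^ m * (t - s)\<close> of the cell satisfies \<open>v \<le> 1\<close>, so that \<open>v \<le> v powr \<gamma>\<close>, and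
  the powers of \<open>2\<close> cancel.\<close>

lemma dyadic_polygonal_Hoelder_cell:
  assumes k: "1 \<le> k" "real k / 2 ^ m \<le> 1"
    and st: "(real k - 1) / 2 ^ m \<le> s" "s \<le> t" "t \<le> real k / 2 ^ m"
  shows "norm (dyadic_polygonal m X t - dyadic_polygonal m X s) \<le> K * (t - s) powr \<gamma>"
proof -
  let ?\<Delta> = "X (real k / 2 ^ m) - X ((real k - 1) / 2 ^ m)"
  define e where "e = (real k - 1) / 2 ^ m"
  have affine: "dyadic_polygonal m X u = X e + (2 ^ m * (u - e)) *\<^sub>R ?\<Delta>"
    if "e \<le> u" "u \<le> real k / 2 ^ m" for u
    using dyadic_polygonal_eq[OF k(1)] that unfolding e_def by blast
  have "dyadic_polygonal m X t - dyadic_polygonal m X s = (2 ^ m * (t - e) - 2 ^ m * (s - e)) *\<^sub>R ?\<Delta>"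
    using affine[of t] affine[of s] st by (simp add: e_def scaleR_diff_left)
  also have "2 ^ m * (t - e) - 2 ^ m * (s - e) = 2 ^ m * (t - s)"
    by (simp add: algebra_simps)
  finally have "norm (dyadic_polygonal m X t - dyadic_polygonal m X s) = 2 ^ m * (t - s) * norm ?\<Delta>"
    using st by simp
  also have "\<dots> \<le> 2 ^ m * (t - s) * (K * (1 / 2 ^ m) powr \<gamma>)"
  proof (intro mult_left_mono)
    have "real k / 2 ^ m - (real k - 1) / 2 ^ m = 1 / 2 ^ m" by (simp add: field_simps)
    then show "norm ?\<Delta> \<le> K * (1 / 2 ^ m) powr \<gamma>"
      using hoelder[of "(real k - 1) / 2 ^ m" "real k / 2 ^ m"] k by (simp add: divide_right_mono)
  qed (use st in auto)
  also have "\<dots> \<le> (2 ^ m * (t - s)) powr \<gamma> * (K * (1 / 2 ^ m) powr \<gamma>)"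
  proof (intro mult_right_mono)
    have "2 ^ m * (t - s) \<le> 1" using st by (simp add: field_simps)
    then show "2 ^ m * (t - s) \<le> (2 ^ m * (t - s)) powr \<gamma>"
      using \<gamma> st powr_mono'[of \<gamma> 1 "2 ^ m * (t - s)"] by simp
  qed (use K in auto)
  also have "\<dots> = K * (t - s) powr \<gamma>"
    using st by (simp add: powr_mult powr_divide)
  finally show ?thesis .
qed

text \<open>For \<open>s\<close> and \<open>t\<close> in different cells, insert the right end \<open>s'\<close> of the cell of \<open>s\<close> and the left
  end \<open>t'\<close> of the cell of \<open>t\<close>. At these grid points the polygon agrees with the path, so the middle
  piece is controlled by the path and the outer two by the bound within a cell.\<close>

lemma dyadic_polygonal_Hoelder:
  assumes st: "0 \<le> s" "s \<le> t" "t \<le> 1"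
  shows "norm (dyadic_polygonal m X t - dyadic_polygonal m X s) \<le> 3 * K * (t - s) powr \<gamma>"
proof -
  let ?P = "dyadic_polygonal m X"
  obtain k where k: "1 \<le> k" "(real k - 1) / 2 ^ m \<le> s" "s \<le> real k / 2 ^ m" "real k / 2 ^ m \<le> 1"
    using dyadic_index[of s m] st by auto
  obtain l where l: "1 \<le> l" "(real l - 1) / 2 ^ m \<le> t" "t \<le> real l / 2 ^ m" "real l / 2 ^ m \<le> 1"
    using dyadic_index[of t m] st by auto
  show ?thesis
  proof (cases "t \<le> real k / 2 ^ m")
    case True
    then have "norm (?P t - ?P s) \<le> K * (t - s) powr \<gamma>"
      using k st by (intro dyadic_polygonal_Hoelder_cell[of k]) auto
    moreover have "0 \<le> K * (t - s) powr \<gamma>" using K by simp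
    ultimately show ?thesis by linarith
  next
    case False
    define s' where "s' = real k / 2 ^ m"
    define t' where "t' = (real l - 1) / 2 ^ m"
    have "real k / 2 ^ m < real l / 2 ^ m" using False l by linarith
    then have "k < l" by (simp add: divide_less_cancel)
    then have ord: "s \<le> s'" "s' \<le> t'" "t' \<le> t"
      using k l by (auto simp: s'_def t'_def divide_right_mono)
    have Ps: "?P s' = X s'"
      using k(1) by (subst dyadic_polygonal_eq[of k]) (auto simp: s'_def divide_right_mono field_simps)
    have Pt: "?P t' = X t'"
      using l(1) by (subst dyadic_polygonal_eq[of l]) (auto simp: t'_def divide_right_mono)
    have le: "K * (v - u) powr \<gamma> \<le> K * (t - s) powr \<gamma>" if "s \<le> u" "u \<le> v" "v \<le> t" for u v
      using that \<gamma> K by (intro mult_left_mono powr_mono2) auto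
    have 1: "norm (?P s' - ?P s) \<le> K * (t - s) powr \<gamma>"
      using dyadic_polygonal_Hoelder_cell[of k m s s'] le[of s s'] k ord by (auto simp: s'_def)
    have 2: "norm (?P t' - ?P s') \<le> K * (t - s) powr \<gamma>"
      using hoelder[of s' t'] le[of s' t'] ord st by (auto simp: Ps Pt)
    have 3: "norm (?P t - ?P t') \<le> K * (t - s) powr \<gamma>"
      using dyadic_polygonal_Hoelder_cell[of l m t' t] le[of t' t] l ord by (auto simp: t'_def)
    have "?P t - ?P s = (?P t - ?P t') + (?P t' - ?P s') + (?P s' - ?P s)" by simp
    then have "norm (?P t - ?P s) \<le> norm (?P t - ?P t') + norm (?P t' - ?P s') + norm (?P s' - ?P s)"
      using norm_triangle_ineq[of "(?P t - ?P t') + (?P t' - ?P s')" "?P s' - ?P s"]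
        norm_triangle_ineq[of "?P t - ?P t'" "?P t' - ?P s'"] by simp
    with 1 2 3 show ?thesis by linarith
  qed
qed

text \<open>Polygon and path agree at the left end of the cell of \<open>t\<close>, and from there to \<open>t\<close> each moves by
  at most \<open>K * (1 / 2 ^ m) powr \<gamma>\<close>.\<close>

lemma dyadic_polygonal_uniform_error:
  assumes t: "0 \<le> t" "t \<le> 1"
  shows "norm (dyadic_polygonal m X t - X t) \<le> 2 * K * (1 / 2 ^ m) powr \<gamma>"
proof -
  let ?P = "dyadic_polygonal m X"
  obtain k where k: "1 \<le> k" "(real k - 1) / 2 ^ m \<le> t" "t \<le> real k / 2 ^ m" "real k / 2 ^ m \<le> 1"
    using dyadic_index[of t m] t by auto
  define s where "s = (real k - 1) / 2 ^ m"
  have s: "0 \<le> s" "s \<le> t" "t - s \<le> 1 / 2 ^ m"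
    using k by (auto simp: s_def field_simps)
  have Ps: "?P s = X s"
    using k(1) by (subst dyadic_polygonal_eq[of k]) (auto simp: s_def divide_right_mono)
  have le: "K * (t - s) powr \<gamma> \<le> K * (1 / 2 ^ m) powr \<gamma>"
    using s \<gamma> K by (intro mult_left_mono powr_mono2) auto
  have "norm (?P t - ?P s) \<le> K * (t - s) powr \<gamma>"
    using k s by (intro dyadic_polygonal_Hoelder_cell[of k]) (auto simp: s_def)
  moreover have "norm (X t - X s) \<le> K * (t - s) powr \<gamma>"
    using s t by (intro hoelder) auto
  moreover have "norm (?P t - X t) \<le> norm (?P t - ?P s) + norm (X t - X s)"
    using norm_triangle_ineq4[of "?P t - ?P s" "X t - X s"] by (simp add: Ps)
  ultimately show ?thesis using le by linarith
qed

lemma finite_p_variation_of_Hoelder: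
  assumes "1 / \<gamma> \<le> p"
  shows "finite_p_variation p X"
proof -
  have "norm (X t - X s) \<le> K" if st: "0 \<le> s" "s \<le> t" "t \<le> 1" for s t
  proof -
    have "K * (t - s) powr \<gamma> \<le> K * 1"
      using st \<gamma> K by (intro mult_left_mono powr_le1) auto
    with hoelder[OF st] show ?thesis by simp
  qed
  from p_variation_le_of_Hoelder[OF \<gamma>(1) assms K hoelder this]
  have "p_variation p X \<le> ennreal ((K powr (p - 1 / \<gamma>) * K powr (1 / \<gamma>)) powr (1 / p))" .
  also have "\<dots> < \<infinity>" by simp
  finally show ?thesis unfolding finite_p_variation_def .
qed

text \<open>The difference of polygon and path has a Hoelder constant \<open>4 * K\<close> that does not depend on
  \<open>m\<close>, and its oscillation \<open>\<delta> m\<close> tends to \<open>0\<close>. In the interpolation bound \<open>\<delta> m\<close> carries the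
  exponent \<open>p - 1 / \<gamma>\<close>, which is positive exactly because the inequality between \<open>1 / \<gamma>\<close> and \<open>p\<close>
  is strict.\<close>

lemma dyadic_polygonal_tendsto_p_variation:
  assumes p: "1 / \<gamma> < p"
  shows "tendsto_p_variation p (\<lambda>m. dyadic_polygonal m X) X"
proof -
  let ?Y = "\<lambda>m t. dyadic_polygonal m X t - X t"
  define \<delta> where "\<delta> m = 4 * K * ((1/2) powr \<gamma>) ^ m" for m
  have scale: "(1 / 2 ^ m) powr \<gamma> = ((1/2) powr \<gamma>) ^ m" for m
    by (simp add: power_powr_swap flip: power_one_over)
  have Y: "norm (?Y m t - ?Y m s) \<le> 4 * K * (t - s) powr \<gamma>" "norm (?Y m t - ?Y m s) \<le> \<delta> m"
    if st: "0 \<le> s" "s \<le> t" "t \<le> 1" for m s t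
  proof -
    have "?Y m t - ?Y m s = (dyadic_polygonal m X t - dyadic_polygonal m X s) - (X t - X s)" by simp
    then have "norm (?Y m t - ?Y m s) \<le> norm (dyadic_polygonal m X t - dyadic_polygonal m X s) + norm (X t - X s)"
      by (metis norm_triangle_ineq4)
    with dyadic_polygonal_Hoelder[OF st, of m] hoelder[OF st]
    show "norm (?Y m t - ?Y m s) \<le> 4 * K * (t - s) powr \<gamma>" by linarith
    show "norm (?Y m t - ?Y m s) \<le> \<delta> m"
      using norm_triangle_ineq4[of "?Y m t" "?Y m s"] dyadic_polygonal_uniform_error[of t m]
        dyadic_polygonal_uniform_error[of s m] st unfolding \<delta>_def scale by linarith
  qed
  define b where "b m = (\<delta> m powr (p - 1 / \<gamma>) * (4 * K) powr (1 / \<gamma>)) powr (1 / p)" for m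
  have bound: "p_variation p (?Y m) \<le> ennreal (b m)" for m
    unfolding b_def using \<gamma> p K by (intro p_variation_le_of_Hoelder Y) auto
  have p0: "0 < p" using p \<gamma> by (smt (verit) divide_pos_pos)
  have "\<delta> \<longlonglongrightarrow> 4 * K * 0"
    unfolding \<delta>_def using \<gamma> by (intro tendsto_intros LIMSEQ_power_zero) (auto simp: powr_less_one powr_divide)
  then have "\<delta> \<longlonglongrightarrow> 0" by simp
  then have "(\<lambda>m. \<delta> m powr (p - 1 / \<gamma>)) \<longlonglongrightarrow> 0 powr (p - 1 / \<gamma>)"
    by (rule tendsto_powr'[OF _ tendsto_const]) (use p K in \<open>auto simp: \<delta>_def\<close>)
  then have "(\<lambda>m. \<delta> m powr (p - 1 / \<gamma>) * (4 * K) powr (1 / \<gamma>)) \<longlonglongrightarrow> 0 * (4 * K) powr (1 / \<gamma>)"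
    by (intro tendsto_mult tendsto_const) simp
  then have "b \<longlonglongrightarrow> 0 powr (1 / p)"
    unfolding b_def using p0 by (intro tendsto_powr' tendsto_const) (auto simp: K)
  then have "(\<lambda>m. ennreal (b m)) \<longlonglongrightarrow> 0"
    using tendsto_ennrealI[of b 0] by simp
  then show ?thesis
    unfolding tendsto_p_variation_def
    by (rule tendsto_sandwich[OF _ _ tendsto_const, rotated 2]) (auto simp: bound)
qed

end

section \<open>The Brownian frame process\<close>

text \<open>At each window position \<open>u\<close> the increment of the frame is the path increment between
  \<open>g - 1 + u\<close> and \<open>h - 1 + u\<close>, two times at distance \<open>h - g\<close> whatever \<open>u\<close> is. Since
  \<open>h - g \<le> 1\<close>, a Hoelder bound for time differences up to \<open>1\<close> is enough.\<close>

lemma frame_Hoelder: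
  assumes K: "\<And>s t. - 1 \<le> s \<Longrightarrow> s \<le> t \<Longrightarrow> t \<le> 1 \<Longrightarrow> t \<le> s + 1 \<Longrightarrow>
      \<bar>coord t f - coord s f\<bar> \<le> K * (t - s) powr \<gamma>"
    and gh: "0 \<le> g" "g \<le> h" "h \<le> 1"
  shows "norm (frame f h - frame f g) \<le> K * (h - g) powr \<gamma>"
proof (rule norm_bound)
  fix u
  show "norm (apply_bcontfun (frame f h - frame f g) u) \<le> K * (h - g) powr \<gamma>"
    using K[of "g - 1 + of_unit u" "h - 1 + of_unit u"] of_unit[of u] gh
    by (simp add: apply_frame coord_def)
qed

theorem proposition30:
  fixes W :: "(sym_icc \<Rightarrow>\<^sub>C real) measure"
  assumes "wiener_measure W"
  shows "(AE f in completion W. \<forall>p>2. finite_p_variation p (frame f)) \<and>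
    (AE f in completion W. \<forall>p>2.
      tendsto_p_variation p (\<lambda>m. dyadic_polygonal m (frame f)) (frame f))"
proof -
  \<comment> \<open>Exponents below \<open>1/2\<close> whose reciprocals decrease to \<open>2\<close>, so that every
    \<open>p > 2\<close> exceeds one of them. Countably many null sets suffice.\<close>
  define \<gamma> where "\<gamma> j = 1 / (2 + 1 / real (Suc j))" for j
  have \<gamma>: "0 < \<gamma> j" "\<gamma> j < 1/2" for j
    by (auto simp: \<gamma>_def add_pos_pos field_simps)
  have B: "brownian_motion_on W (of_int (- 1)) (of_int 1) coord"
    using assms by (simp add: wiener_measure_def)
  have "AE f in W. \<forall>j. \<exists>K\<ge>0. \<forall>s t. of_int (- 1) \<le> s \<longrightarrow> s \<le> t \<longrightarrow> t \<le> of_int 1 \<longrightarrow> t \<le> s + 1 \<longrightarrow>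
      \<bar>coord t f - coord s f\<bar> \<le> K * (t - s) powr \<gamma> j"
    unfolding AE_all_countable using Brownian_motion_Hoelder[OF B \<gamma>] by blast
  then have "AE f in W. \<forall>p>2. finite_p_variation p (frame f) \<and>
      tendsto_p_variation p (\<lambda>m. dyadic_polygonal m (frame f)) (frame f)"
  proof eventually_elim
    case (elim f)
    show ?case
    proof (intro allI impI)
      fix p :: real assume "2 < p"
      then obtain j where j: "1 / real (Suc j) < p - 2"
        using reals_Archimedean[of "p - 2"] by (auto simp: inverse_eq_divide)
      have p: "1 / \<gamma> j < p" using j by (simp add: \<gamma>_def)
      obtain K where K: "0 \<le> K" "\<And>s t. - 1 \<le> s \<Longrightarrow> s \<le> t \<Longrightarrow> t \<le> 1 \<Longrightarrow> t \<le> s + 1 \<Longrightarrow>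
          \<bar>coord t f - coord s f\<bar> \<le> K * (t - s) powr \<gamma> j"
        using elim[rule_format, of j] by auto
      have \<gamma>1: "\<gamma> j \<le> 1" using \<gamma>[of j] by simp
      note H = \<gamma>(1)[of j] \<gamma>1 K(1) frame_Hoelder[OF K(2)]
      show "finite_p_variation p (frame f) \<and>
          tendsto_p_variation p (\<lambda>m. dyadic_polygonal m (frame f)) (frame f)"
        using finite_p_variation_of_Hoelder[OF H less_imp_le[OF p]]
          dyadic_polygonal_tendsto_p_variation[OF H p] by simp
    qed
  qed
  then have "AE f in completion W. \<forall>p>2. finite_p_variation p (frame f) \<and>
      tendsto_p_variation p (\<lambda>m. dyadic_polygonal m (frame f)) (frame f)"
    by (rule AE_completion)
  then show ?thesis
    by (auto elim: AE_mp intro: AE_I2)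
qed

end
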